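(* Let $\mathcal{H}$ be a real Hilbert space, and let $A \in \mathcal{B}(\mathcal{H})$ be a positive self-adjoint operator. Assume that $\|A\|$ is a simple eigenvalue of $A$, and let $u_0 \in \ker(\|A\| I - A)$ be a unit vector. Then $A$ is a positivity improving operator with respect to the cone $\mathcal{P}(u_0)$.
   Context: $\mathcal{B}(\mathcal{H})$ is the set of bounded linear operators on $\mathcal{H}$, and $I$ is the identity. Positive means $\langle u, Au\rangle \ge 0$ for all $u\in\mathcal{H}$. A simple eigenvalue is one whose eigenspace is one-dimensional. For a unit vector $u_0 \in \mathcal{H}$, the cone with $u_0$ as its axis is $\mathcal{P}(u_0) := \{ u \in \mathcal{H} \mid \langle u_0, u\rangle \ge \|u\|/\sqrt{2}\}$; it is a Hilbert cone. Here a Hilbert cone in $\mathcal{H}$ is a non-empty subset $\mathcal{C}\subset\mathcal{H}$ such that: (i) $\mathcal{C}+\mathcal{C}\subset\mathcal{C}$, $[0,\infty)\cdot\mathcal{C}\subset\mathcal{C}$ and $\mathcal{C}\cap(-\mathcal{C})=\{0\}$; (ii) $\mathcal{C}$ is closed; (iii) $\langle u,v\rangle\ge 0$ for all $u,v\in\mathcal{C}$; (iv) for every $w\in\mathcal{H}$ there exist $u,v\in\mathcal{C}$ with $w=u-v$ and $\langle u,v\rangle=0$. For a Hilbert cone $\mathcal{C}$, the set of strictly positive vectors is $\mathcal{C}_{>0} := \{u\in\mathcal{C}\setminus\{0\} \mid \langle v,u\rangle>0 \text{ for all } v\in\mathcal{C}\setminus\{0\}\}$. An operator $A\in\mathcal{B}(\mathcal{H})$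 is positivity improving with respect to $\mathcal{C}$ if $A(\mathcal{C}\setminus\{0\})\subset\mathcal{C}_{>0}$.
   Formalization: The assumption A ≠ 0 is added: for one-dimensional H and A = 0, ‖A‖ = 0 is a simple eigenvalue but A sends the cone to {0}, so the claim fails; this is the only case excluded. *)

theory Defs
  imports "HOL-Analysis.Analysis"
begin

text \<open>
  A real Hilbert space is a type of sort \<open>{real_inner, complete_space}\<close>; \<open>\<B>(\<H>)\<close> is the type
  \<open>'a \<Rightarrow>\<^sub>L 'a\<close>, whose norm is the operator norm.
\<close>

text \<open>The adjoint of \<open>A\<close> is the unique \<open>B\<close> with \<open>\<langle>A u, v\<rangle> = \<langle>u, B v\<rangle>\<close>. The library constant
  \<open>adjoint\<close> is a choice whose existence is only established there in finite dimension, so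
  \<open>A = A\<^sup>*\<close> is written out through this defining identity.\<close>

definition self_adjoint :: "('a::real_inner \<Rightarrow>\<^sub>L 'a) \<Rightarrow> bool" where
  "self_adjoint A \<longleftrightarrow> (\<forall>u v. inner (blinfun_apply A u) v = inner u (blinfun_apply A v))"

definition positive_operator :: "('a::real_inner \<Rightarrow>\<^sub>L 'a) \<Rightarrow> bool" where
  "positive_operator A \<longleftrightarrow> (\<forall>u. 0 \<le> inner u (blinfun_apply A u))"

definition op_kernel :: "('a::real_normed_vector \<Rightarrow>\<^sub>L 'a) \<Rightarrow> 'a set" where
  "op_kernel A = {u. blinfun_apply A u = 0}"

definition eigenspace :: "('a::real_normed_vector \<Rightarrow>\<^sub>L 'a) \<Rightarrow> real \<Rightarrow> 'a set" where
  "eigenspace A c = op_kernel (c *\<^sub>R id_blinfun - A)"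

definition eigenvalue :: "('a::real_normed_vector \<Rightarrow>\<^sub>L 'a) \<Rightarrow> real \<Rightarrow> bool" where
  "eigenvalue A c \<longleftrightarrow> (\<exists>u. u \<noteq> 0 \<and> blinfun_apply A u = c *\<^sub>R u)"

definition simple_eigenvalue :: "('a::real_normed_vector \<Rightarrow>\<^sub>L 'a) \<Rightarrow> real \<Rightarrow> bool" where
  "simple_eigenvalue A c \<longleftrightarrow> eigenvalue A c \<and> dim (eigenspace A c) = 1"

definition hilbert_cone :: "'a::real_inner set \<Rightarrow> bool" where
  "hilbert_cone C \<longleftrightarrow>
     C \<noteq> {} \<and>
     (\<forall>u\<in>C. \<forall>v\<in>C. u + v \<in> C) \<and>
     (\<forall>t\<ge>0. \<forall>u\<in>C. t *\<^sub>R u \<in> C) \<and>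
     C \<inter> uminus ` C = {0} \<and>
     closed C \<and>
     (\<forall>u\<in>C. \<forall>v\<in>C. 0 \<le> inner u v) \<and>
     (\<forall>w. \<exists>u\<in>C. \<exists>v\<in>C. w = u - v \<and> inner u v = 0)"

definition axis_cone :: "'a::real_inner \<Rightarrow> 'a set" where
  "axis_cone u0 = {u. inner u0 u \<ge> norm u / sqrt 2}"

text \<open>These two notions are meant for Hilbert cones only; \<open>axis_cone u0\<close> is one by
  \<open>hilbert_cone_axis_cone\<close> below.\<close>

definition strictly_positive :: "'a::real_inner set \<Rightarrow> 'a set" where
  "strictly_positive C = {u \<in> C - {0}. \<forall>v \<in> C - {0}. inner v u > 0}"

definition positivity_improving :: "'a::real_inner set \<Rightarrow> ('a \<Rightarrow>\<^sub>L 'a) \<Rightarrow> bool" where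
  "positivity_improving C A \<longleftrightarrow> blinfun_apply A ` (C - {0}) \<subseteq> strictly_positive C"

lemma axis_cone_decomp:
  fixes u0 :: "'a::real_inner"
  assumes u0: "norm u0 = 1"
  obtains x where "u = (inner u0 u) *\<^sub>R u0 + x" "inner u0 x = 0" "inner x u0 = 0"
    "(norm u)\<^sup>2 = (inner u0 u)\<^sup>2 + (norm x)\<^sup>2"
proof -
  define x where "x = u - (inner u0 u) *\<^sub>R u0"
  have i: "inner u0 u0 = 1" using u0 by (simp add: norm_eq_1)
  have o: "inner u0 x = 0" by (simp add: x_def inner_diff_right i)
  have "(norm u)\<^sup>2 = (inner u0 u)\<^sup>2 + (norm x)\<^sup>2"
    unfolding power2_norm_eq_inner x_def
    by (simp add: inner_diff_right inner_diff_left i inner_commute[of u u0] power2_eq_square algebra_simps)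
  with o show ?thesis by (intro that[of x]) (auto simp: x_def inner_commute)
qed

lemma axis_cone_iff:
  fixes u0 :: "'a::real_inner"
  assumes u0: "norm u0 = 1" and o: "inner u0 x = 0"
  shows "a *\<^sub>R u0 + x \<in> axis_cone u0 \<longleftrightarrow> norm x \<le> a"
proof -
  have i: "inner u0 u0 = 1" using u0 by (simp add: norm_eq_1)
  have o': "inner x u0 = 0" using o by (simp add: inner_commute)
  have n: "(norm (a *\<^sub>R u0 + x))\<^sup>2 = a\<^sup>2 + (norm x)\<^sup>2"
    unfolding power2_norm_eq_inner
    by (simp add: inner_add_right inner_add_left i o o' power2_eq_square)
  have "a *\<^sub>R u0 + x \<in> axis_cone u0 \<longleftrightarrow> norm (a *\<^sub>R u0 + x) \<le> a * sqrt 2"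
    by (simp add: axis_cone_def inner_add_right i o divide_simps)
  also have "\<dots> \<longleftrightarrow> 0 \<le> a \<and> (norm (a *\<^sub>R u0 + x))\<^sup>2 \<le> (a * sqrt 2)\<^sup>2"
  proof (intro iffI conjI)
    assume h: "norm (a *\<^sub>R u0 + x) \<le> a * sqrt 2"
    have "0 \<le> a * sqrt 2" using norm_ge_zero h by (rule order_trans)
    then show "0 \<le> a" by (simp add: zero_le_mult_iff)
    show "(norm (a *\<^sub>R u0 + x))\<^sup>2 \<le> (a * sqrt 2)\<^sup>2" using h by (rule power_mono) simp
  next
    assume "0 \<le> a \<and> (norm (a *\<^sub>R u0 + x))\<^sup>2 \<le> (a * sqrt 2)\<^sup>2"
    then show "norm (a *\<^sub>R u0 + x) \<le> a * sqrt 2"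
      using power2_le_imp_le[of "norm (a *\<^sub>R u0 + x)" "a * sqrt 2"] by simp
  qed
  also have "\<dots> \<longleftrightarrow> 0 \<le> a \<and> (norm x)\<^sup>2 \<le> a\<^sup>2"
    by (simp add: n power_mult_distrib)
  also have "\<dots> \<longleftrightarrow> norm x \<le> a"
    using power2_le_imp_le[of "norm x" a] power_mono[of "norm x" a 2]
      order_trans[OF norm_ge_zero, of x a] by auto
  finally show ?thesis .
qed

lemma hilbert_cone_axis_cone:
  fixes u0 :: "'a::real_inner"
  assumes u0: "norm u0 = 1"
  shows "hilbert_cone (axis_cone u0)"
proof -
  let ?P = "axis_cone u0"
  have i: "inner u0 u0 = 1" using u0 by (simp add: norm_eq_1)
  have z: "0 \<in> ?P" by (simp add: axis_cone_def)
  have add: "u + v \<in> ?P" if "u \<in> ?P" "v \<in> ?P" for u v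
  proof -
    have "norm (u + v) / sqrt 2 \<le> (norm u + norm v) / sqrt 2"
      by (intro divide_right_mono norm_triangle_ineq) auto
    with that show ?thesis by (simp add: axis_cone_def inner_add_right add_divide_distrib)
  qed
  have scale: "t *\<^sub>R u \<in> ?P" if "t \<ge> 0" "u \<in> ?P" for t u
    using that mult_left_mono[of "norm u / sqrt 2" "inner u0 u" t]
    by (simp add: axis_cone_def)
  have salient: "?P \<inter> uminus ` ?P = {0}"
  proof -
    have "u = 0" if "u \<in> ?P" "- u \<in> ?P" for u
    proof -
      have "norm u / sqrt 2 \<le> 0" using that by (simp add: axis_cone_def)
      then show ?thesis by (simp add: divide_le_0_iff)
    qed
    then show ?thesis using z by (auto simp: image_iff)
  qed
  have closed: "closed ?P"
    unfolding axis_cone_def by (intro closed_Collect_le continuous_intros) auto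
  have pos: "0 \<le> inner u v" if u: "u \<in> ?P" and v: "v \<in> ?P" for u v
  proof -
    define a where "a = inner u0 u"
    define b where "b = inner u0 v"
    obtain x where x: "u = a *\<^sub>R u0 + x" "inner u0 x = 0" "inner x u0 = 0"
      unfolding a_def by (rule axis_cone_decomp[OF u0])
    obtain y where y: "v = b *\<^sub>R u0 + y" "inner u0 y = 0" "inner y u0 = 0"
      unfolding b_def by (rule axis_cone_decomp[OF u0])
    have nx: "norm x \<le> a" using u x(1) axis_cone_iff[OF u0 x(2), of a] by simp
    have ny: "norm y \<le> b" using v y(1) axis_cone_iff[OF u0 y(2), of b] by simp
    have "inner u v = a * b + inner x y"
      by (simp add: x y inner_add_left inner_add_right i)
    moreover have "\<bar>inner x y\<bar> \<le> norm x * norm y" by (rule Cauchy_Schwarz_ineq2)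
    moreover have "norm x * norm y \<le> a * b"
      using nx ny order_trans[OF norm_ge_zero nx] by (rule mult_mono) simp
    ultimately show ?thesis by linarith
  qed
  have dec: "\<exists>u\<in>?P. \<exists>v\<in>?P. w = u - v \<and> inner u v = 0" for w
  proof -
    define a where "a = inner u0 w"
    obtain x where x: "w = a *\<^sub>R u0 + x" "inner u0 x = 0" "inner x u0 = 0"
      unfolding a_def by (rule axis_cone_decomp[OF u0])
    consider "norm x \<le> a" | "norm x \<le> - a" | "\<bar>a\<bar> < norm x" by linarith
    then show ?thesis
    proof cases
      case 1
      then have "w \<in> ?P" using axis_cone_iff[OF u0 x(2)] x(1) by simp
      with z show ?thesis by (intro bexI[of _ w] bexI[of _ 0]) auto
    next
      case 2
      have "(- a) *\<^sub>R u0 + (- x) \<in> ?P" using axis_cone_iff[OF u0, of "- x" "- a"] x(2) 2 by simp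
      then have "- w \<in> ?P" using x(1) by simp
      with z show ?thesis by (intro bexI[of _ 0] bexI[of _ "- w"]) auto
    next
      case 3
      define n where "n = norm x"
      have n: "n > 0" "\<bar>a\<bar> < n" using 3 by (auto simp: n_def)
      define s where "s = (n + a) / 2"
      define t where "t = (n - a) / 2"
      have st: "s > 0" "t > 0" "s - t = a" "s + t = n"
        using n by (auto simp: s_def t_def field_simps)
      define e where "e = (1 / n) *\<^sub>R x"
      have e: "inner u0 e = 0" "inner e u0 = 0" "norm e = 1" "x = n *\<^sub>R e"
        using n x by (auto simp: e_def n_def)
      have ee: "inner e e = 1" using e(3) by (simp add: norm_eq_1)
      let ?u = "s *\<^sub>R u0 + s *\<^sub>R e" and ?v = "t *\<^sub>R u0 + (- t) *\<^sub>R e"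
      have "?u \<in> ?P" using axis_cone_iff[OF u0, of "s *\<^sub>R e" s] e st by simp
      moreover have "?v \<in> ?P" using axis_cone_iff[OF u0, of "(- t) *\<^sub>R e" t] e st by simp
      moreover have "w = ?u - ?v"
        unfolding x(1) e(4) st(3)[symmetric] st(4)[symmetric] by (simp add: algebra_simps)
      moreover have "inner ?u ?v = 0"
        by (simp add: inner_add_left inner_add_right inner_diff_left inner_diff_right e i ee)
      ultimately show ?thesis by blast
    qed
  qed
  show ?thesis
    unfolding hilbert_cone_def
  proof (intro conjI)
    show "?P \<noteq> {}" using z by blast
    show "\<forall>u\<in>?P. \<forall>v\<in>?P. u + v \<in> ?P" using add by blast
    show "\<forall>t\<ge>0. \<forall>u\<in>?P. t *\<^sub>R u \<in> ?P" using scale by blast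
    show "\<forall>u\<in>?P. \<forall>v\<in>?P. 0 \<le> inner u v" using pos by blast
    show "\<forall>w. \<exists>u\<in>?P. \<exists>v\<in>?P. w = u - v \<and> inner u v = 0" using dec by (rule allI)
  qed (fact salient closed)+
qed

end

theory Submission
  imports Defs
begin

text \<open>
  Write \<open>n = \<parallel>A\<parallel>\<close>. A nonzero vector of the cone has the form \<open>a u\<^sub>0 + x\<close> with \<open>x \<perp> u\<^sub>0\<close> and
  \<open>\<parallel>x\<parallel> \<le> a\<close>, \<open>0 < a\<close>, and \<open>A\<close> sends it to \<open>(n a) u\<^sub>0 + A x\<close>, where \<open>A x \<perp> u\<^sub>0\<close> by
  self-adjointness. Since \<open>\<parallel>A x\<parallel> \<le> n \<parallel>x\<parallel> \<le> n a\<close>, the image lies in the cone. It lies in the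
  interior, hence is strictly positive (\<open>strictly_positive_axis_coneI\<close>), once
  \<open>\<parallel>A x\<parallel> < n a\<close>.

  The only way to lose strictness is \<open>\<parallel>A x\<parallel> = n \<parallel>x\<parallel>\<close> with \<open>x \<noteq> 0\<close>. But a vector on which a
  positive self-adjoint operator attains its norm is an eigenvector for the norm
  (\<open>norm_attained_imp_eigenvector\<close>). The eigenspace being the line through \<open>u\<^sub>0\<close>, to which \<open>x\<close> is
  orthogonal, this forces \<open>x = 0\<close> (\<open>norm_less_orthogonal_simple\<close>).
\<close>

text \<open>
  Norm attainment at \<open>x\<close> makes \<open>\<parallel>A\<^sup>2 x - n\<^sup>2 x\<parallel>\<^sup>2\<close> nonpositive when expanded, so
  \<open>(A + n)(A - n) x = 0\<close>. Positivity rules out the eigenvalue \<open>-n\<close>, hence \<open>(A - n) x = 0\<close>.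
\<close>

lemma norm_attained_imp_eigenvector:
  fixes A :: "'a::real_inner \<Rightarrow>\<^sub>L 'a"
  assumes pos: "positive_operator A" and sa: "self_adjoint A"
    and attained: "norm (A x) = norm A * norm x"
  shows "A x = norm A *\<^sub>R x"
proof (cases "A = 0")
  case True
  then show ?thesis by simp
next
  case False
  define n where "n = norm A"
  have n: "n > 0" using False by (simp add: n_def)
  have "inner (A (A x)) x = (norm (A x))\<^sup>2"
    using sa by (simp add: self_adjoint_def power2_norm_eq_inner)
  then have "(norm (A (A x) - n\<^sup>2 *\<^sub>R x))\<^sup>2
      = (norm (A (A x)))\<^sup>2 - 2 * n\<^sup>2 * (norm (A x))\<^sup>2 + n\<^sup>2 * (n\<^sup>2 * (norm x)\<^sup>2)"
    unfolding power2_norm_eq_inner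
    by (simp add: inner_diff_left inner_diff_right inner_commute[of x "A (A x)"] algebra_simps power2_eq_square)
  also have "\<dots> = (norm (A (A x)))\<^sup>2 - (n * norm (A x))\<^sup>2"
    using attained by (simp add: n_def power_mult_distrib algebra_simps)
  also have "\<dots> \<le> 0"
    using power_mono[OF norm_blinfun[of A "A x"], of 2] by (simp add: n_def)
  finally have sq: "A (A x) = n\<^sup>2 *\<^sub>R x" by simp
  define y where "y = A x - n *\<^sub>R x"
  have "A y = - n *\<^sub>R y"
    by (simp add: y_def blinfun.diff_right blinfun.scaleR_right sq algebra_simps power2_eq_square)
  moreover have "0 \<le> inner y (A y)" using pos by (simp add: positive_operator_def)
  ultimately have "n * (norm y)\<^sup>2 \<le> 0" by (simp add: power2_norm_eq_inner)
  with n have "y = 0" by (simp add: mult_le_0_iff)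
  then show ?thesis by (simp add: y_def n_def)
qed

lemma mem_eigenspace_iff: "x \<in> eigenspace A c \<longleftrightarrow> A x = c *\<^sub>R x"
  by (auto simp: eigenspace_def op_kernel_def blinfun.diff_left blinfun.scaleR_left)

lemma simple_eigenvalue_eigenvectors_parallel:
  assumes "simple_eigenvalue A c" and "x \<in> eigenspace A c"
    and "u \<in> eigenspace A c" and "u \<noteq> 0"
  obtains r where "x = r *\<^sub>R u"
proof -
  obtain B where B: "eigenspace A c \<subseteq> span B" "card B = dim (eigenspace A c)"
    by (rule basis_exists)
  then obtain b where "B = {b}"
    using assms(1) by (auto simp: simple_eigenvalue_def card_1_singleton_iff)
  with B(1) have "eigenspace A c \<subseteq> range (\<lambda>k. k *\<^sub>R b)"
    by (simp add: span_singleton)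
  then obtain s t where st: "x = s *\<^sub>R b" "u = t *\<^sub>R b"
    using assms(2,3) by blast
  then have "x = (s / t) *\<^sub>R u" using assms(4) by simp
  then show ?thesis by (rule that)
qed

text \<open>This strict contraction is where simplicity of the eigenvalue enters.\<close>

lemma norm_less_orthogonal_simple:
  fixes A :: "'a::real_inner \<Rightarrow>\<^sub>L 'a"
  assumes "positive_operator A" and "self_adjoint A"
    and simple: "simple_eigenvalue A (norm A)"
    and u: "u \<in> eigenspace A (norm A)" "u \<noteq> 0"
    and x: "inner u x = 0" "x \<noteq> 0"
  shows "norm (A x) < norm A * norm x"
proof (rule ccontr)
  assume "\<not> norm (A x) < norm A * norm x"
  then have "norm (A x) = norm A * norm x"
    using norm_blinfun[of A x] by simp
  then have "x \<in> eigenspace A (norm A)"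
    using norm_attained_imp_eigenvector[OF assms(1,2)] by (simp add: mem_eigenspace_iff)
  then obtain r where "x = r *\<^sub>R u"
    using simple_eigenvalue_eigenvectors_parallel[OF simple _ u] by blast
  with u(2) x show False by simp
qed

lemma axis_cone_nonzero_decomp:
  fixes u0 :: "'a::real_inner"
  assumes u0: "norm u0 = 1" and v: "v \<in> axis_cone u0 - {0}"
  obtains a x where "v = a *\<^sub>R u0 + x" "inner u0 x = 0" "norm x \<le> a" "0 < a"
proof -
  obtain x where x: "v = inner u0 v *\<^sub>R u0 + x" "inner u0 x = 0"
    by (rule axis_cone_decomp[OF u0])
  have le: "norm x \<le> inner u0 v"
    using v x(1) axis_cone_iff[OF u0 x(2), of "inner u0 v"] by simp
  have "inner u0 v \<noteq> 0"
  proof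
    assume "inner u0 v = 0"
    with le x(1) v show False by simp
  qed
  with le norm_ge_zero[of x] have "0 < inner u0 v" by linarith
  with x le show ?thesis by (rule that)
qed

text \<open>
  Against \<open>c u\<^sub>0 + z\<close> in the cone the inner product is
  \<open>b c + \<langle>z, y\<rangle> \<ge> b c - \<parallel>z\<parallel> \<parallel>y\<parallel> \<ge> c (b - \<parallel>y\<parallel>)\<close>.
\<close>

lemma strictly_positive_axis_coneI:
  fixes u0 :: "'a::real_inner"
  assumes u0: "norm u0 = 1" and y: "inner u0 y = 0" "norm y < b"
  shows "b *\<^sub>R u0 + y \<in> strictly_positive (axis_cone u0)"
proof -
  let ?w = "b *\<^sub>R u0 + y"
  have i: "inner u0 u0 = 1" using u0 by (simp add: norm_eq_1)
  have "?w \<in> axis_cone u0" using axis_cone_iff[OF u0 y(1)] y(2) by simp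
  moreover have "inner u0 ?w = b" by (simp add: inner_add_right i y(1))
  then have "?w \<noteq> 0" using y(2) norm_ge_zero[of y] by auto
  moreover have "0 < inner v ?w" if v: "v \<in> axis_cone u0 - {0}" for v
  proof -
    obtain c z where z: "v = c *\<^sub>R u0 + z" "inner u0 z = 0" "norm z \<le> c" "0 < c"
      by (rule axis_cone_nonzero_decomp[OF u0 v])
    have "inner v ?w = c * b + inner z y"
      using z(2) y(1) by (simp add: z(1) inner_add_left inner_add_right i inner_commute[of z u0])
    moreover have "\<bar>inner z y\<bar> \<le> norm z * norm y" by (rule Cauchy_Schwarz_ineq2)
    moreover have "norm z * norm y \<le> c * norm y" using z(3) by (rule mult_right_mono) simp
    moreover have "c * norm y < c * b" using z(4) y(2) by simp
    ultimately show ?thesis by linarith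
  qed
  ultimately show ?thesis by (simp add: strictly_positive_def)
qed

theorem theorem3p4:
  fixes A :: "'a::{real_inner, complete_space} \<Rightarrow>\<^sub>L 'a" and u0 :: 'a
  assumes "positive_operator A"
    and "self_adjoint A"
    and "A \<noteq> 0"
    and "simple_eigenvalue A (norm A)"
    and "u0 \<in> op_kernel (norm A *\<^sub>R id_blinfun - A)"
    and "norm u0 = 1"
  shows "positivity_improving (axis_cone u0) A"
  unfolding positivity_improving_def
proof (rule image_subsetI)
  fix u assume "u \<in> axis_cone u0 - {0}"
  then obtain a x where u: "u = a *\<^sub>R u0 + x" and x: "inner u0 x = 0" "norm x \<le> a" and a: "0 < a"
    by (rule axis_cone_nonzero_decomp[OF assms(6)])
  have eig: "u0 \<in> eigenspace A (norm A)" using assms(5) by (simp add: eigenspace_def)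
  then have Au0: "A u0 = norm A *\<^sub>R u0" by (simp add: mem_eigenspace_iff)
  have "u0 \<noteq> 0" using assms(6) by auto
  have "inner u0 (A x) = inner (A u0) x" using assms(2) by (simp add: self_adjoint_def)
  also have "\<dots> = 0" by (simp add: Au0 x(1))
  finally have orth: "inner u0 (A x) = 0" .
  have less: "norm (A x) < norm A * a"
  proof (cases "x = 0")
    case True
    then show ?thesis using a assms(3) by (simp add: blinfun.zero_right)
  next
    case False
    have "norm (A x) < norm A * norm x"
      by (rule norm_less_orthogonal_simple[OF assms(1,2,4) eig \<open>u0 \<noteq> 0\<close> x(1) False])
    also have "\<dots> \<le> norm A * a" using x(2) by (rule mult_left_mono) simp
    finally show ?thesis .
  qed
  have "A u = (norm A * a) *\<^sub>R u0 + A x"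
    by (simp add: u blinfun.add_right blinfun.scaleR_right Au0 mult.commute)
  then show "A u \<in> strictly_positive (axis_cone u0)"
    using strictly_positive_axis_coneI[OF assms(6) orth less] by simp
qed

end
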